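(* Let $A:\Sigma\to\mathbb{R}$ be a Hölder potential whose maximizing probability $\mu_{\infty,A}$ is unique, and let $W$ be the involution kernel for $A$, with dual potential $A^*$ whose maximizing probability is $\mu_{\infty,A^*}$. Then the minimizing Kantorovich probability $\hat\mu$ on $\hat\Sigma$ associated to $-W$, that is, the minimizer of $$\hat\eta\mapsto\iint -W(x,y)\,d\hat\eta(x,y)\qquad\text{over }\hat\eta\in\mathcal{K}(\mu_{\infty,A},\mu_{\infty,A^*}),$$ is $\hat\mu_{max}$, the natural extension of $\mu_{\infty,A}$.
   Context: $\Sigma=\{1,\dots,d\}^{\mathbb{N}}$ is the full one-sided shift space, with points $x=(x_0,x_1,\dots)$, metric $d(x,x')=\lambda^{\min\{j:x_j\ne x'_j\}}$ for a fixed $\lambda\in(0,1)$, and shift $\sigma(x_0,x_1,\dots)=(x_1,x_2,\dots)$. A second copy of $\Sigma$ (also denoted $\Sigma^*$) has points $y=(y_0,y_1,\dots)$ and shift $\sigma^*(y_0,y_1,\dots)=(y_1,y_2,\dots)$. Put $\hat\Sigma=\Sigma\times\Sigma^*$ (points $(x,y)$), identified with $\{1,\dots,d\}^{\mathbb{Z}}$ by $(\dots,y_1,y_0\,|\,x_0,x_1,\dots)$. Set $\tau_y(x)=(y_0,x_0,x_1,\dots)$. The two-sided shift is $\hat\sigma(x,y)=(\sigma(x),(x_0,y_0,y_1,\dots))$, with inverse $\hat\sigma^{-1}(x,y)=(\tau_y(x),\sigma^*(y))$. For continuous $A$, $m(A)=\max\{\int A\,d\nu:\nu\ \text{a }\sigma\text{-invariant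 Borel probability}\}$; an invariant probability attaining the maximum is called maximizing for $A$. The same definitions are used for $A^*$ and $\sigma^*$. A continuous $W:\hat\Sigma\to\mathbb{R}$ is an involution kernel for $A$ if $A(\tau_y(x))+W(\tau_y(x),\sigma^*(y))-W(x,y)$ does not depend on $x$; this function of $y$ is the dual potential $A^*(y)$. When $A$ has a unique maximizing probability, so does $A^*$. $\hat\mu_{max}$ is the natural extension of $\mu_{\infty,A}$: the unique $\hat\sigma$-invariant Borel probability on $\hat\Sigma$ whose projection to the $x$-coordinate is $\mu_{\infty,A}$. $\mathcal{K}(\mu,\mu^* )$ is the set of Borel probabilities on $\hat\Sigma$ with $x$-marginal $\mu$ and $y$-marginal $\mu^*$.
   Formalization: "The minimizer" is read as "a minimizer": the natural extension is shown to lie in the set of couplings and to attain the minimum; uniqueness of the minimizer is not claimed, since it fails in general (e.g. for some Lipschitz A maximized on a 2-cycle, all couplings have equal cost). *)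

theory Defs
  imports "HOL-Probability.Probability" "HOL-Probability.Discrete_Topology"
begin

text \<open>The alphabet is an arbitrary finite type, so its cardinality plays the role of \<open>d\<close>. The type
  constructor \<open>discrete\<close> only equips it with the discrete topology; sequences then carry the product
  topology and its Borel sets. The lemma \<open>mtopology_shift_dist\<close> below shows that this
  is the topology of the metric \<open>shift_dist\<close>.\<close>

type_synonym 'd sequence = "nat \<Rightarrow> 'd discrete"

definition shift_dist :: "real \<Rightarrow> 'd sequence \<Rightarrow> 'd sequence \<Rightarrow> real" where
  "shift_dist lam x x' = (if x = x' then 0 else lam ^ (LEAST j. x j \<noteq> x' j))"

definition holder :: "real \<Rightarrow> ('d sequence \<Rightarrow> real) \<Rightarrow> bool" where
  "holder lam A \<longleftrightarrow>
     (\<exists>C \<alpha>. 0 < \<alpha> \<and> \<alpha> \<le> 1 \<and> (\<forall>x x'. \<bar>A x - A x'\<bar> \<le> C * shift_dist lam x x' powr \<alpha>))"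

definition shift :: "'d sequence \<Rightarrow> 'd sequence" where
  "shift x = (\<lambda>n. x (Suc n))"

definition prepend :: "'d discrete \<Rightarrow> 'd sequence \<Rightarrow> 'd sequence" where
  "prepend a x = case_nat a x"

definition tau :: "'d sequence \<Rightarrow> 'd sequence \<Rightarrow> 'd sequence" where
  "tau y x = prepend (y 0) x"

text \<open>A pair \<open>(x, y)\<close> stands for the two-sided sequence \<open>\<dots>, y 1, y 0 | x 0, x 1, \<dots>\<close>.\<close>

definition two_sided_shift :: "'d sequence \<times> 'd sequence \<Rightarrow> 'd sequence \<times> 'd sequence" where
  "two_sided_shift = (\<lambda>(x, y). (shift x, prepend (x 0) y))"

definition borel_prob :: "'a::topological_space measure \<Rightarrow> bool" where
  "borel_prob \<nu> \<longleftrightarrow> prob_space \<nu> \<and> sets \<nu> = sets borel"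

definition invariant_prob :: "('a::topological_space \<Rightarrow> 'a) \<Rightarrow> 'a measure \<Rightarrow> bool" where
  "invariant_prob T \<nu> \<longleftrightarrow> borel_prob \<nu> \<and> distr \<nu> borel T = \<nu>"

definition maximizing :: "('d::finite sequence \<Rightarrow> real) \<Rightarrow> 'd sequence measure \<Rightarrow> bool" where
  "maximizing A \<mu> \<longleftrightarrow>
     invariant_prob shift \<mu> \<and> (\<forall>\<nu>. invariant_prob shift \<nu> \<longrightarrow> (\<integral>x. A x \<partial>\<nu>) \<le> (\<integral>x. A x \<partial>\<mu>))"

definition involution_kernel ::
    "('d sequence \<Rightarrow> real) \<Rightarrow> ('d sequence \<times> 'd sequence \<Rightarrow> real) \<Rightarrow> bool" where
  "involution_kernel A W \<longleftrightarrow> continuous_on UNIV W \<and>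
     (\<forall>y. \<exists>a. \<forall>x. A (tau y x) + W (tau y x, shift y) - W (x, y) = a)"

definition dual_potential ::
    "('d sequence \<Rightarrow> real) \<Rightarrow> ('d sequence \<times> 'd sequence \<Rightarrow> real) \<Rightarrow> 'd sequence \<Rightarrow> real" where
  "dual_potential A W y = (THE a. \<forall>x. A (tau y x) + W (tau y x, shift y) - W (x, y) = a)"

definition natural_extension ::
    "'d::finite sequence measure \<Rightarrow> ('d sequence \<times> 'd sequence) measure" where
  "natural_extension \<mu> =
     (THE \<eta>. invariant_prob two_sided_shift \<eta> \<and> distr \<eta> borel fst = \<mu>)"

definition couplings :: "'a::topological_space measure \<Rightarrow> 'b::topological_space measure \<Rightarrow>
    ('a \<times> 'b) measure set" where
  "couplings \<mu> \<nu> = {\<eta>. borel_prob \<eta> \<and> distr \<eta> borel fst = \<mu> \<and> distr \<eta> borel snd = \<nu>}"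

text \<open>Uniqueness of a minimizer is not part of the definition: for the cost \<open>- W\<close> of an involution
  kernel, several couplings can attain the minimum even if the maximizing probability is unique.\<close>

definition kantorovich_minimizer :: "('a::topological_space \<times> 'b::topological_space \<Rightarrow> real) \<Rightarrow>
    'a measure \<Rightarrow> 'b measure \<Rightarrow> ('a \<times> 'b) measure \<Rightarrow> bool" where
  "kantorovich_minimizer c \<mu> \<nu> = is_arg_min (\<lambda>\<eta>. \<integral>p. c p \<partial>\<eta>) (\<lambda>\<eta>. \<eta> \<in> couplings \<mu> \<nu>)"

lemma shift_dist_less_iff:
  assumes "0 < lam" "lam < 1"
  shows "shift_dist lam x x' < lam ^ n \<longleftrightarrow> (\<forall>i\<le>n. x i = x' i)"
proof (cases "x = x'")
  case True
  then show ?thesis using assms by (simp add: shift_dist_def)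
next
  case False
  then have ex: "\<exists>j. x j \<noteq> x' j" by auto
  define m where "m = (LEAST j. x j \<noteq> x' j)"
  have m: "x m \<noteq> x' m" "\<And>i. i < m \<Longrightarrow> x i = x' i"
    using LeastI_ex[OF ex] not_less_Least unfolding m_def by auto
  have "shift_dist lam x x' < lam ^ n \<longleftrightarrow> n < m"
    using False assms by (simp add: shift_dist_def m_def power_strict_decreasing_iff)
  also have "\<dots> \<longleftrightarrow> (\<forall>i\<le>n. x i = x' i)"
    using m by (meson le_less_trans not_le)
  finally show ?thesis .
qed

lemma Metric_space_shift_dist:
  assumes "0 < lam" "lam < 1"
  shows "Metric_space UNIV (shift_dist lam)"
proof
  fix x y z :: "'a sequence"
  show nonneg: "0 \<le> shift_dist lam x y" for x y :: "'a sequence"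
    using assms by (simp add: shift_dist_def)
  show "shift_dist lam x y = shift_dist lam y x"
    by (simp add: shift_dist_def eq_commute)
  show "shift_dist lam x y = 0 \<longleftrightarrow> x = y"
    using assms by (simp add: shift_dist_def)
  show "shift_dist lam x z \<le> shift_dist lam x y + shift_dist lam y z"
  proof (rule ccontr)
    assume less: "\<not> ?thesis"
    then have "x \<noteq> z" using nonneg[of x y] nonneg[of y z] by (auto simp: shift_dist_def)
    then obtain n where n: "shift_dist lam x z = lam ^ n" by (auto simp: shift_dist_def)
    have "shift_dist lam x y < lam ^ n" "shift_dist lam y z < lam ^ n"
      using less n nonneg[of x y] nonneg[of y z] by linarith+
    then have "shift_dist lam x z < lam ^ n"
      by (simp add: shift_dist_less_iff[OF assms])
    then show False using n by simp
  qed
qed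

lemma mtopology_shift_dist:
  assumes "0 < lam" "lam < 1"
  shows "Metric_space.mtopology UNIV (shift_dist lam) = (euclidean :: 'd sequence topology)"
proof -
  interpret Metric_space "UNIV :: 'd sequence set" "shift_dist lam"
    by (rule Metric_space_shift_dist[OF assms])
  have "openin mtopology U \<longleftrightarrow> open U" for U :: "'d sequence set"
  proof
    assume U: "openin mtopology U"
    show "open U"
    proof (subst open_subopen, intro ballI)
      fix x assume "x \<in> U"
      then obtain r where r: "r > 0" "mball x r \<subseteq> U" using U by (auto simp: openin_mtopology)
      obtain n where n: "lam ^ n < r" using real_arch_pow_inv[OF r(1) assms(2)] by blast
      define X where "X i = (if i \<le> n then {x i} else UNIV)" for i
      have "open (Pi\<^sub>E UNIV X)"
        by (rule open_PiE)
          (auto simp: X_def open_discrete intro: finite_subset[of _ "{..n}"])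
      moreover have "x \<in> Pi\<^sub>E UNIV X" by (auto simp: X_def)
      moreover have "Pi\<^sub>E UNIV X \<subseteq> U"
      proof
        fix y assume y: "y \<in> Pi\<^sub>E UNIV X"
        have "\<forall>i\<le>n. x i = y i"
        proof (intro allI impI)
          fix i assume "i \<le> n"
          then show "x i = y i" using PiE_mem[OF y, of i] by (simp add: X_def)
        qed
        then have "shift_dist lam x y < lam ^ n" by (simp add: shift_dist_less_iff[OF assms])
        then show "y \<in> U" using r n by (auto simp: mball_def)
      qed
      ultimately show "\<exists>T. open T \<and> x \<in> T \<and> T \<subseteq> U" by blast
    qed
  next
    assume U: "open U"
    show "openin mtopology U"
      unfolding openin_mtopology
    proof (intro conjI allI impI)
      fix x assume "x \<in> U"
      then obtain X where X: "x \<in> Pi\<^sub>E UNIV X" "finite {i. X i \<noteq> UNIV}" "Pi\<^sub>E UNIV X \<subseteq> U"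
        using product_topology_open_contains_basis[of "\<lambda>_::nat. euclidean :: 'd discrete topology" UNIV U x]
          U unfolding open_fun_def by auto
      obtain n where n: "\<And>i. X i \<noteq> UNIV \<Longrightarrow> i \<le> n"
        using X(2) by (auto simp: finite_nat_set_iff_bounded_le)
      have "mball x (lam ^ n) \<subseteq> U"
      proof
        fix y assume "y \<in> mball x (lam ^ n)"
        then have eq: "\<forall>i\<le>n. x i = y i" by (simp add: shift_dist_less_iff[OF assms])
        have "y i \<in> X i" for i
        proof (cases "X i = UNIV")
          case False
          then have "x i = y i" using eq n[of i] by simp
          then show ?thesis using PiE_mem[OF X(1), of i] by simp
        qed simp
        then show "y \<in> U" using X(3) by auto
      qed
      then show "\<exists>r>0. mball x r \<subseteq> U" using assms by (intro exI[of _ "lam ^ n"]) auto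
    qed auto
  qed
  then show ?thesis by (simp add: topology_eq)
qed

end

theory Submission
  imports Defs
begin

text \<open>
  The proof compares an arbitrary coupling \<open>P\<close> of \<open>mu\<close> and \<open>mu_star\<close> with the natural extension
  \<open>\<eta>\<close> of \<open>mu\<close> by moving \<open>P\<close> along the backward shift \<open>unshift\<close>, the inverse of the two-sided shift.
  In a point \<open>(x, y)\<close> the sequence \<open>x\<close> is called the future and \<open>y\<close> the past.

  Let \<open>m\<close> be the maximal value of \<open>A\<close> over invariant probabilities, and \<open>A\<^sup>*\<close> the dual potential. The
  equation of the involution kernel is \<open>W (x, y) = W (unshift (x, y)) + A (tau y x) - A\<^sup>* y\<close>. Since
  \<open>A\<close> is Hoelder continuous there is a continuous subaction \<open>V\<close>, that is \<open>A z - m \<le> V (shift z) - V z\<close>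
  (\<open>exists_continuous_subaction\<close>). With \<open>z = tau y x\<close>, the function \<open>U (x, y) = W (x, y) - V x\<close> satisfies
  \<open>U (x, y) \<le> U (unshift (x, y)) + (m - A\<^sup>* y)\<close>. The last term depends only on the past \<open>y\<close>, and its
  integral against \<open>mu_star\<close> vanishes because \<open>A\<close> and \<open>A\<^sup>*\<close> have the same maximal value. The past marginal
  \<open>mu_star\<close> is shift invariant and hence kept by \<open>unshift\<close>. So the integral of \<open>U\<close> does not decrease when \<open>P\<close> is
  moved by \<open>unshift\<close>.

  Under iteration of \<open>unshift\<close> the initial future \<open>x\<close> is pushed away to infinity, so the limiting
  integrals depend only on the past marginal (\<open>unshift_forgets_future\<close>). The invariant measure \<open>\<eta>\<close> also has past
  marginal \<open>mu_star\<close> (\<open>past_marginal_natural_extension\<close>); hence the integrals of \<open>U\<close> along \<open>P\<close> increase to its integral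
  under \<open>\<eta>\<close>. Finally, \<open>V\<close> depends only on \<open>x\<close> and has the same integral under both couplings, so the
  inequality for \<open>U\<close> is the desired inequality for \<open>W\<close>.

  Existence and uniqueness of the natural extension rest on the one-sided windows
  \<open>halfline n\<close> of a two-sided sequence: their laws determine the measure
  (\<open>borel_prob_eqI_halfline\<close>), and for an invariant measure they all equal the future marginal.
\<close>

section \<open>The two-sided shift and its half-lines\<close>

definition unshift :: "'d sequence \<times> 'd sequence \<Rightarrow> 'd sequence \<times> 'd sequence" where
  "unshift = (\<lambda>(x, y). (tau y x, shift y))"

text \<open>The window of the two-sided sequence that starts \<open>n\<close> places to the left of the origin and runs to the
  right: \<open>y (n - 1), \<dots>, y 0, x 0, x 1, \<dots>\<close>. Written through iterates of \<open>unshift\<close>, its law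
  under an invariant measure is immediate.\<close>

definition halfline :: "nat \<Rightarrow> 'd sequence \<times> 'd sequence \<Rightarrow> 'd sequence" where
  "halfline n p = fst ((unshift ^^ n) p)"

lemma shift_prepend [simp]: "shift (prepend a x) = x"
  by (simp add: shift_def prepend_def)

lemma prepend_0 [simp]: "prepend a x 0 = a"
  and prepend_Suc [simp]: "prepend a x (Suc n) = x n"
  by (simp_all add: prepend_def)

lemma prepend_shift [simp]: "prepend (x 0) (shift x) = x"
  by (auto simp: shift_def prepend_def split: nat.split)

lemma unshift_two_sided_shift [simp]: "unshift (two_sided_shift p) = p"
  by (cases p) (simp add: unshift_def two_sided_shift_def tau_def)

lemma two_sided_shift_unshift [simp]: "two_sided_shift (unshift p) = p"
  by (cases p) (simp add: unshift_def two_sided_shift_def tau_def)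

lemma snd_unshift: "snd (unshift p) = shift (snd p)"
  by (cases p) (simp add: unshift_def)

lemma fst_unshift: "fst (unshift p) = prepend (snd p 0) (fst p)"
  by (cases p) (simp add: unshift_def tau_def)

lemma fst_two_sided_shift: "fst (two_sided_shift p) = shift (fst p)"
  by (cases p) (simp add: two_sided_shift_def)

lemma funpow_shift: "(shift ^^ n) x = (\<lambda>i. x (n + i))"
  by (induction n) (simp_all add: shift_def)

lemma snd_unshift_funpow: "snd ((unshift ^^ n) p) = (shift ^^ n) (snd p)"
  by (induction n) (simp_all add: snd_unshift)

lemma halfline_0 [simp]: "halfline 0 p = fst p"
  by (simp add: halfline_def)

lemma halfline_Suc: "halfline (Suc n) p = prepend (snd p n) (halfline n p)"
  by (simp add: halfline_def fst_unshift snd_unshift_funpow funpow_shift)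

lemma halfline_Suc_0: "halfline (Suc n) p 0 = snd p n"
  by (simp add: halfline_Suc)

lemma halfline_unshift: "halfline n (unshift p) = halfline (Suc n) p"
  by (simp only: halfline_def funpow_Suc_right o_apply)

lemma shift_halfline: "shift (halfline (Suc n) p) = halfline n p"
  by (simp add: halfline_Suc)

lemma funpow_shift_halfline: "(shift ^^ k) (halfline (n + k) p) = halfline n p"
  by (induction k arbitrary: n) (simp_all add: funpow_Suc_right shift_halfline del: funpow.simps(2))

text \<open>The first \<open>n\<close> letters of the window come from the past \<open>y\<close> alone. This is why the backward shift
  forgets the future \<open>x\<close>.\<close>

lemma halfline_eq_if_same_past:
  assumes "snd p = snd q" "i < n"
  shows "halfline n p i = halfline n q i"
  using assms(2)
proof (induction n arbitrary: i)
  case (Suc n)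
  then show ?case using assms(1) by (cases i) (simp_all add: halfline_Suc)
qed simp

section \<open>Topology of sequence spaces\<close>

lemma continuous_on_shift [continuous_intros]:
  "continuous_on S f \<Longrightarrow> continuous_on S (\<lambda>p. shift (f p))"
  unfolding shift_def
  by (rule continuous_on_coordinatewise_then_product)
    (erule continuous_on_product_then_coordinatewise)

lemma continuous_on_prepend [continuous_intros]:
  assumes "continuous_on S f" "continuous_on S g"
  shows "continuous_on S (\<lambda>p. prepend (f p) (g p))"
proof (rule continuous_on_coordinatewise_then_product)
  fix i show "continuous_on S (\<lambda>p. prepend (f p) (g p) i)"
    using assms continuous_on_product_then_coordinatewise[OF assms(2)] by (cases i) simp_all
qed

lemma continuous_on_unshift [continuous_intros]:
  assumes "continuous_on S f"
  shows "continuous_on S (\<lambda>p. unshift (f p))"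
proof -
  have "continuous_on S (\<lambda>p. snd (f p) 0)"
    by (rule continuous_on_product_then_coordinatewise[OF continuous_on_snd[OF assms]])
  then show ?thesis
    unfolding unshift_def case_prod_beta tau_def
    by (intro continuous_on_Pair continuous_on_prepend continuous_on_shift continuous_on_fst
        continuous_on_snd assms)
qed

lemma continuous_on_two_sided_shift [continuous_intros]:
  assumes "continuous_on S f"
  shows "continuous_on S (\<lambda>p. two_sided_shift (f p))"
proof -
  have "continuous_on S (\<lambda>p. fst (f p) 0)"
    by (rule continuous_on_product_then_coordinatewise[OF continuous_on_fst[OF assms]])
  then show ?thesis
    unfolding two_sided_shift_def case_prod_beta
    by (intro continuous_on_Pair continuous_on_prepend continuous_on_shift continuous_on_fst
        continuous_on_snd assms)
qed

lemma continuous_on_unshift_funpow [continuous_intros]: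
  "continuous_on S f \<Longrightarrow> continuous_on S (\<lambda>p. (unshift ^^ n) (f p))"
  by (induction n) (simp_all add: continuous_on_unshift)

lemma continuous_on_halfline [continuous_intros]:
  "continuous_on S f \<Longrightarrow> continuous_on S (\<lambda>p. halfline n (f p))"
  unfolding halfline_def by (intro continuous_intros)

lemma borel_measurable_two_sided [measurable]:
  "shift \<in> borel \<rightarrow>\<^sub>M (borel :: 'd sequence measure)"
  "unshift \<in> borel \<rightarrow>\<^sub>M (borel :: ('d sequence \<times> 'd sequence) measure)"
  "unshift ^^ n \<in> borel \<rightarrow>\<^sub>M (borel :: ('d sequence \<times> 'd sequence) measure)"
  "two_sided_shift \<in> borel \<rightarrow>\<^sub>M (borel :: ('d sequence \<times> 'd sequence) measure)"
  "halfline n \<in> borel \<rightarrow>\<^sub>M (borel :: 'd sequence measure)"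
  "fst \<in> borel \<rightarrow>\<^sub>M (borel :: 'd sequence measure)"
  "snd \<in> borel \<rightarrow>\<^sub>M (borel :: 'd sequence measure)"
  "prod.swap \<in> borel \<rightarrow>\<^sub>M (borel :: ('d sequence \<times> 'd sequence) measure)"
  using continuous_on_shift[OF continuous_on_id] continuous_on_unshift[OF continuous_on_id]
    continuous_on_unshift_funpow[OF continuous_on_id] continuous_on_two_sided_shift[OF continuous_on_id]
    continuous_on_halfline[OF continuous_on_id] continuous_on_fst[OF continuous_on_id]
    continuous_on_snd[OF continuous_on_id] continuous_on_swap
  by (auto intro!: borel_measurable_continuous_onI simp: id_def)

lemma compact_UNIV_sequence: "compact (UNIV :: 'd::finite sequence set)"
proof -
  have "(UNIV :: 'd discrete set) = discrete ` UNIV"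
    by (auto intro: discrete_cases)
  then have "compact (UNIV :: 'd discrete set)"
    by (metis finite finite_imageI finite_imp_compact)
  then have "compact_space (product_topology (\<lambda>_::nat. euclidean :: 'd discrete topology) UNIV)"
    unfolding compact_space_product_topology by (simp add: compact_space_def)
  then show ?thesis
    unfolding euclidean_product_topology by (simp add: compact_space_def)
qed

lemma compact_UNIV_two_sided: "compact (UNIV :: ('d::finite sequence \<times> 'd sequence) set)"
  using compact_Times[OF compact_UNIV_sequence compact_UNIV_sequence] by simp

lemma integrable_continuous:
  fixes f :: "'a::t2_space \<Rightarrow> real"
  assumes "borel_prob M" "compact (UNIV :: 'a set)" "continuous_on UNIV f"
  shows "integrable M f"
proof -
  interpret prob_space M using assms(1) by (simp add: borel_prob_def)
  have "bounded (range f)"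
    by (rule compact_imp_bounded[OF compact_continuous_image[OF assms(3,2)]])
  then obtain B where "\<And>x. norm (f x) \<le> B" by (auto simp: bounded_iff)
  moreover have "f \<in> borel_measurable M"
    using borel_measurable_continuous_onI[OF assms(3)] assms(1)
    by (simp add: borel_prob_def cong: measurable_cong_sets)
  ultimately show ?thesis by (intro integrable_const_bound[of _ B]) auto
qed

text \<open>The metric of the product topology weighs coordinates through an enumeration of the index set, so
  the coordinates that matter up to a given precision are finitely many but need not be the first ones;
  \<open>m\<close> bounds them all.\<close>

lemma dist_fun_tendsto_0:
  fixes u v :: "nat \<Rightarrow> 'd sequence"
  assumes "\<And>n i. i < n \<Longrightarrow> u n i = v n i"
  shows "(\<lambda>n. dist (u n) (v n)) \<longlonglongrightarrow> 0"
proof (rule LIMSEQ_I)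
  fix e :: real assume "0 < e"
  then obtain N where N: "(1/2) ^ N < e" using real_arch_pow_inv[of e "1/2"] by auto
  define m where "m = Suc (Max (from_nat ` {..N} :: nat set))"
  show "\<exists>no. \<forall>n\<ge>no. norm (dist (u n) (v n) - 0) < e"
  proof (intro exI[of _ m] allI impI)
    fix n assume n: "m \<le> n"
    have "u n (from_nat k) = v n (from_nat k)" if "k \<le> N" for k
    proof (rule assms)
      have "from_nat k \<le> Max (from_nat ` {..N} :: nat set)" using that by (intro Max_ge) auto
      then show "from_nat k < n" using n by (simp add: m_def)
    qed
    then have "{dist (u n (from_nat k)) (v n (from_nat k)) |k. k \<le> N} = {0}"
      by (auto intro!: exI[of _ 0])
    then have "dist (u n) (v n) \<le> (1/2) ^ N"
      using dist_fun_le_dist_first_terms[of "u n" "v n" N] by simp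
    then show "norm (dist (u n) (v n) - 0) < e" using N by simp
  qed
qed

section \<open>Images of invariant probabilities\<close>

lemma borel_prob_distr:
  assumes "borel_prob M" "f \<in> borel \<rightarrow>\<^sub>M borel"
  shows "borel_prob (distr M borel f)"
  using assms prob_space.prob_space_distr[of M f borel]
  by (simp add: borel_prob_def cong: measurable_cong_sets)

lemma distr_distr_borel:
  assumes "borel_prob M" "f \<in> borel \<rightarrow>\<^sub>M borel" "g \<in> borel \<rightarrow>\<^sub>M borel"
  shows "distr (distr M borel f) borel g = distr M borel (\<lambda>x. g (f x))"
  using assms by (subst distr_distr) (auto simp: borel_prob_def o_def cong: measurable_cong_sets)

lemma integral_distr_borel:
  fixes f :: "'b::topological_space \<Rightarrow> real"
  assumes "borel_prob M" "T \<in> borel \<rightarrow>\<^sub>M borel" "continuous_on UNIV f"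
  shows "(\<integral>x. f x \<partial>distr M borel T) = (\<integral>x. f (T x) \<partial>M)"
  using assms borel_measurable_continuous_onI[OF assms(3)]
  by (intro integral_distr) (auto simp: borel_prob_def cong: measurable_cong_sets)

lemma distr_funpow_invariant:
  assumes "invariant_prob T M" "T \<in> borel \<rightarrow>\<^sub>M borel"
  shows "distr M borel (T ^^ n) = M"
proof (induction n)
  case 0
  then show ?case using assms(1)
    by (simp add: invariant_prob_def borel_prob_def id_def distr_id2)
next
  case (Suc n)
  have "T ^^ n \<in> borel \<rightarrow>\<^sub>M borel" using assms(2) by (rule measurable_compose_n)
  then have "distr (distr M borel (T ^^ n)) borel T = distr M borel (T ^^ Suc n)"
    using assms by (subst distr_distr_borel) (auto simp: invariant_prob_def o_def)
  then show ?case using assms(1) by (simp only: Suc invariant_prob_def)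
qed

lemma invariant_prob_inverse:
  assumes "invariant_prob S M" "S \<in> borel \<rightarrow>\<^sub>M borel" "T \<in> borel \<rightarrow>\<^sub>M borel" "\<And>x. T (S x) = x"
  shows "invariant_prob T M"
proof -
  have "distr (distr M borel S) borel T = distr M borel (\<lambda>x. x)"
    using assms by (subst distr_distr_borel) (auto simp: invariant_prob_def)
  also have "\<dots> = M" using assms(1) by (simp add: invariant_prob_def borel_prob_def distr_id2)
  finally show ?thesis using assms(1) by (simp add: invariant_prob_def)
qed

lemma invariant_prob_factor:
  assumes "invariant_prob T M" "T \<in> borel \<rightarrow>\<^sub>M borel" "S \<in> borel \<rightarrow>\<^sub>M borel"
    and "f \<in> borel \<rightarrow>\<^sub>M borel" "\<And>x. f (T x) = S (f x)"
  shows "invariant_prob S (distr M borel f)"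
proof -
  have "distr (distr M borel f) borel S = distr M borel (\<lambda>x. f (T x))"
    using assms by (subst distr_distr_borel) (auto simp: invariant_prob_def)
  also have "\<dots> = distr (distr M borel T) borel f"
    using assms by (subst distr_distr_borel) (auto simp: invariant_prob_def)
  also have "\<dots> = distr M borel f" using assms(1) by (simp add: invariant_prob_def)
  finally show ?thesis using assms by (simp add: invariant_prob_def borel_prob_distr)
qed

section \<open>Natural extensions\<close>

text \<open>The laws of the windows determine a two-sided measure. Two windows are both images of a longer
  one under powers of the shift, so the sets that constrain a single window are closed under
  intersection; they generate the Borel sets because every coordinate occurs in some window.\<close>

lemma borel_prob_eqI_halfline:
  fixes M N :: "('d::finite sequence \<times> 'd sequence) measure"
  assumes "borel_prob M" "borel_prob N"
    and "\<And>n. distr M borel (halfline n) = distr N borel (halfline n)"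
  shows "M = N"
proof -
  define E where "E = {halfline n -` B | n B. B \<in> sets (borel :: 'd sequence measure)}"
  interpret M: prob_space M using assms(1) by (simp add: borel_prob_def)
  have E_borel: "E \<subseteq> sets borel"
    using measurable_sets_borel[OF borel_measurable_two_sided(5)] by (auto simp: E_def)
  have meas: "halfline n \<in> sigma UNIV E \<rightarrow>\<^sub>M borel" for n
    by (rule measurableI) (auto simp: E_def intro!: in_measure_of)
  have "(\<lambda>p. halfline n p i) \<in> sigma UNIV E \<rightarrow>\<^sub>M borel" for n i
    by (rule measurable_product_then_coordinatewise[OF meas])
  from this[of "Suc _" 0] have "snd \<in> sigma UNIV E \<rightarrow>\<^sub>M (borel :: 'd sequence measure)"
    by (intro measurable_coordinatewise_then_product) (simp add: halfline_Suc_0)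
  moreover have "fst \<in> sigma UNIV E \<rightarrow>\<^sub>M (borel :: 'd sequence measure)"
    using meas[of 0] by (simp add: halfline_def[abs_def])
  ultimately have "(\<lambda>p. (fst p, snd p)) \<in> sigma UNIV E \<rightarrow>\<^sub>M (borel \<Otimes>\<^sub>M borel :: ('d sequence \<times> 'd sequence) measure)"
    by (intro measurable_Pair)
  then have id: "(\<lambda>p. p) \<in> sigma UNIV E \<rightarrow>\<^sub>M (borel :: ('d sequence \<times> 'd sequence) measure)"
    by (simp add: borel_prod)
  have "sets borel \<subseteq> sigma_sets UNIV E"
    using measurable_sets[OF id] by auto
  moreover have "sigma_sets UNIV E \<subseteq> sets borel"
    using sets.sigma_sets_subset[OF E_borel] by simp
  ultimately have sigma_E: "sigma_sets UNIV E = sets borel" by blast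
  show ?thesis
  proof (rule measure_eqI_generator_eq[where E = E and \<Omega> = UNIV and A = "\<lambda>_. UNIV"])
    show "Int_stable E"
    proof (rule Int_stableI)
      fix a b assume "a \<in> E" "b \<in> E"
      then obtain n B k C where ab: "a = halfline n -` B" "b = halfline k -` C"
        and BC: "B \<in> sets borel" "C \<in> sets borel" by (auto simp: E_def)
      have "(shift ^^ k) (halfline (n + k) p) = halfline n p"
        "(shift ^^ n) (halfline (n + k) p) = halfline k p" for p :: "'d sequence \<times> 'd sequence"
        using funpow_shift_halfline[of k n p] funpow_shift_halfline[of n k p]
        by (simp_all only: add.commute)
      then have "a = halfline (n + k) -` ((shift ^^ k) -` B)" "b = halfline (n + k) -` ((shift ^^ n) -` C)"
        unfolding ab by auto
      then have "a \<inter> b = halfline (n + k) -` ((shift ^^ k) -` B \<inter> (shift ^^ n) -` C)" by auto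
      moreover have "(shift ^^ k) -` B \<inter> (shift ^^ n) -` C \<in> sets borel"
        using BC measurable_sets_borel[OF measurable_compose_n[OF borel_measurable_two_sided(1)]]
        by (intro sets.Int) auto
      ultimately show "a \<inter> b \<in> E"
        unfolding E_def by (intro CollectI exI conjI)
    qed
    show "emeasure M X = emeasure N X" if "X \<in> E" for X
    proof -
      obtain n B where X: "X = halfline n -` B" "B \<in> sets borel"
        using \<open>X \<in> E\<close>[unfolded E_def] by (elim CollectE exE conjE)
      have "emeasure (distr P borel (halfline n)) B = emeasure P X" if "borel_prob P" for P
        using X that by (subst emeasure_distr)
          (auto simp: borel_prob_def cong: measurable_cong_sets dest: sets_eq_imp_space_eq)
      then show ?thesis using assms by metis
    qed
    show "sets M = sigma_sets UNIV E" "sets N = sigma_sets UNIV E"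
      using assms by (simp_all add: borel_prob_def sigma_E)
    show "range (\<lambda>_. UNIV) \<subseteq> E" by (auto simp: E_def intro!: exI[of _ 0] exI[of _ UNIV])
  qed auto
qed

definition split_at_origin :: "(int \<Rightarrow> 'd discrete) \<Rightarrow> 'd sequence \<times> 'd sequence" where
  "split_at_origin w = (\<lambda>i. w (int i), \<lambda>i. w (- 1 - int i))"

lemma unshift_split_at_origin: "unshift (split_at_origin w) = split_at_origin (\<lambda>j. w (j - 1))"
  by (auto simp: unshift_def split_at_origin_def tau_def shift_def prepend_def algebra_simps
      intro!: ext split: nat.split)

lemma halfline_split_at_origin: "halfline n (split_at_origin w) = (\<lambda>i. w (int i - int n))"
proof -
  have "(unshift ^^ n) (split_at_origin w) = split_at_origin (\<lambda>j. w (j - int n))"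
    by (induction n arbitrary: w)
      (simp_all add: funpow_Suc_right unshift_split_at_origin algebra_simps del: funpow.simps(2))
  then show ?thesis by (simp add: halfline_def split_at_origin_def)
qed

text \<open>Kolmogorov's extension theorem on the index set \<open>\<int>\<close>. The coordinates in a finite \<open>J\<close> are read off
  a one-sided sequence after moving \<open>J\<close> to the right by some \<open>N\<close> with \<open>- N \<le> j\<close> for all \<open>j\<close> in \<open>J\<close>;
  invariance of \<open>M\<close> makes the resulting law independent of \<open>N\<close>, hence the family projective. In
  the limit measure every window has law \<open>M\<close>. The backward shift only turns each window into the
  next longer one, so it preserves these laws and therefore the measure.\<close>

lemma exists_two_sided_extension:
  fixes M :: "'d::finite sequence measure"
  assumes M: "invariant_prob shift M"
  shows "\<exists>\<eta>. invariant_prob two_sided_shift \<eta> \<and> distr \<eta> borel fst = M"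
proof -
  interpret M: prob_space M using M by (simp add: invariant_prob_def borel_prob_def)
  have sets_M [measurable_cong]: "sets M = sets borel"
    using M by (simp add: invariant_prob_def borel_prob_def)
  have [measurable]: "(\<lambda>x. x i) \<in> M \<rightarrow>\<^sub>M borel" for i :: nat
    using measurable_product_then_coordinatewise[of "\<lambda>x. x" borel i]
    by (simp cong: measurable_cong_sets add: sets_M)
  have shift_k [measurable]: "shift ^^ k \<in> borel \<rightarrow>\<^sub>M (borel :: 'd sequence measure)" for k
    by (rule measurable_compose_n) simp
  define law where "law J N = distr M (PiM J (\<lambda>_. borel)) (\<lambda>x. \<lambda>j\<in>J. x (nat (j + int N)))"
    for J :: "int set" and N :: nat
  have law_measurable [measurable]: "(\<lambda>x. \<lambda>j\<in>J. x (nat (j + int N))) \<in> M \<rightarrow>\<^sub>M PiM J (\<lambda>_. borel)" for J N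
    by (rule measurable_restrict) simp
  have law_add: "law J (N + k) = law J N" if J: "\<And>j. j \<in> J \<Longrightarrow> - int N \<le> j" for J N k
  proof -
    have "law J N = distr (distr M borel (shift ^^ k)) (PiM J (\<lambda>_. borel)) (\<lambda>x. \<lambda>j\<in>J. x (nat (j + int N)))"
      by (simp only: law_def distr_funpow_invariant[OF M borel_measurable_two_sided(1)])
    also have "\<dots> = distr M (PiM J (\<lambda>_. borel)) ((\<lambda>x. \<lambda>j\<in>J. x (nat (j + int N))) \<circ> (shift ^^ k))"
      using law_measurable by (intro distr_distr) (simp_all cong: measurable_cong_sets add: sets_M)
    also have "(\<lambda>x. \<lambda>j\<in>J. x (nat (j + int N))) \<circ> (shift ^^ k) = (\<lambda>x. \<lambda>j\<in>J. x (nat (j + int (N + k))) :: 'd discrete)"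
    proof (intro ext)
      fix x :: "'d sequence" and j
      have "k + nat (j + int N) = nat (j + int (N + k))" if "j \<in> J"
        using J[OF that] by simp
      then show "((\<lambda>x. \<lambda>j\<in>J. x (nat (j + int N))) \<circ> (shift ^^ k)) x j = (\<lambda>j\<in>J. x (nat (j + int (N + k)))) j"
        by (simp add: funpow_shift restrict_def)
    qed
    finally show ?thesis unfolding law_def by (rule sym)
  qed
  define off where "off J = (SOME N. \<forall>j\<in>J. - int N \<le> j)" for J
  have off: "- int (off J) \<le> j" if "finite J" "j \<in> J" for J j
  proof -
    obtain b where b: "\<And>j. j \<in> J \<Longrightarrow> b \<le> j"
      using bdd_below_finite[OF \<open>finite J\<close>] by (auto simp: bdd_below_def)
    have "\<exists>N. \<forall>j\<in>J. - int N \<le> j"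
      using b by (intro exI[of _ "nat (- b)"]) fastforce
    from someI_ex[OF this] show ?thesis using that by (simp add: off_def)
  qed
  define P where "P J = law J (off J)" for J
  have P_eq: "P J = law J N" if "finite J" "\<And>j. j \<in> J \<Longrightarrow> - int N \<le> j" for J N
    using law_add[of J N "off J"] law_add[of J "off J" N] that off[of J]
    by (simp add: P_def add.commute)
  interpret lim: polish_projective UNIV P
  proof (intro polish_projective.intro projective_family.intro)
    fix J H :: "int set" assume JH: "J \<subseteq> H" "finite H"
    have "distr (P H) (PiM J (\<lambda>_. borel)) (\<lambda>f. restrict f J) =
      distr M (PiM J (\<lambda>_. borel)) ((\<lambda>f. restrict f J) \<circ> (\<lambda>x. \<lambda>j\<in>H. x (nat (j + int (off H)))))"
      unfolding P_def law_def using JH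
      by (intro distr_distr measurable_restrict_subset law_measurable) auto
    also have "\<dots> = law J (off H)"
      using JH(1) by (simp add: law_def o_def restrict_restrict Int_absorb1)
    also have "\<dots> = P J"
      using JH off[of H] by (intro P_eq[symmetric]) (auto intro: finite_subset)
    finally show "P J = distr (P H) (PiM J (\<lambda>_. borel)) (\<lambda>f. restrict f J)" ..
  next
    fix J :: "int set"
    show "prob_space (P J)"
      unfolding P_def law_def by (rule M.prob_space_distr) simp
  qed
  have coord [measurable]: "(\<lambda>w. w j) \<in> lim.lim \<rightarrow>\<^sub>M borel" for j
    using measurable_component_singleton[of j UNIV] by (simp cong: measurable_cong_sets)
  have half [measurable]: "(\<lambda>w i. w (int i - int n)) \<in> lim.lim \<rightarrow>\<^sub>M borel" for n
    by (rule measurable_coordinatewise_then_product) simp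
  have half_law: "distr lim.lim borel (\<lambda>w i. w (int i - int n)) = M" for n
  proof (rule measure_eqI_PiM_infinite)
    show "sets (distr lim.lim borel (\<lambda>w i. w (int i - int n))) = sets (PiM UNIV (\<lambda>_. borel))"
      by (simp add: sets_PiM_equal_borel)
    show "sets M = sets (PiM UNIV (\<lambda>_. borel))"
      by (simp add: sets_PiM_equal_borel sets_M)
    show "finite_measure (distr lim.lim borel (\<lambda>w i. w (int i - int n)))"
      by (intro prob_space.finite_measure lim.P.prob_space_distr half)
    fix A and J :: "nat set"
    assume J: "finite J" and A: "\<And>i. i \<in> J \<Longrightarrow> A i \<in> sets (borel :: 'd discrete measure)"
    define X where "X = {x :: 'd sequence. \<forall>i\<in>J. x i \<in> A i}"
    have X: "prod_emb UNIV (\<lambda>_. borel) J (Pi\<^sub>E J A) = X"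
      by (auto simp: X_def prod_emb_def PiE_iff)
    have X_sets: "X \<in> sets borel"
      unfolding X[symmetric] sets_PiM_equal_borel[symmetric]
      using J A by (intro sets_PiM_I) auto
    define J' where "J' = (\<lambda>i. int i - int n) ` J"
    define A' where "A' j = A (nat (j + int n))" for j
    have Y_sets: "Pi\<^sub>E J' A' \<in> sets (PiM J' (\<lambda>_. borel))"
      using J A by (intro sets_PiM_I_finite) (auto simp: J'_def A'_def)
    have "emeasure (distr lim.lim borel (\<lambda>w i. w (int i - int n))) X =
        emeasure lim.lim ((\<lambda>w i. w (int i - int n)) -` X \<inter> space lim.lim)"
      by (rule emeasure_distr[OF half X_sets])
    also have "(\<lambda>w i. w (int i - int n)) -` X \<inter> space lim.lim = prod_emb UNIV (\<lambda>_. borel) J' (Pi\<^sub>E J' A')"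
      by (auto simp: X_def J'_def A'_def prod_emb_def PiE_iff space_PiM)
    also have "emeasure lim.lim \<dots> = emeasure (P J') (Pi\<^sub>E J' A')"
      using J by (intro lim.emeasure_lim_emb Y_sets) (auto simp: J'_def)
    also have "P J' = law J' n"
      using J by (intro P_eq) (auto simp: J'_def)
    also have "emeasure (law J' n) (Pi\<^sub>E J' A') =
        emeasure M ((\<lambda>x. \<lambda>j\<in>J'. x (nat (j + int n))) -` Pi\<^sub>E J' A' \<inter> space M)"
      unfolding law_def by (rule emeasure_distr[OF law_measurable Y_sets])
    also have "(\<lambda>x. \<lambda>j\<in>J'. x (nat (j + int n))) -` Pi\<^sub>E J' A' \<inter> space M = X"
      using sets_eq_imp_space_eq[OF sets_M] by (auto simp: X_def J'_def A'_def PiE_iff)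
    finally show "emeasure (distr lim.lim borel (\<lambda>w i. w (int i - int n))) (prod_emb UNIV (\<lambda>_. borel) J (Pi\<^sub>E J A)) =
        emeasure M (prod_emb UNIV (\<lambda>_. borel) J (Pi\<^sub>E J A))"
      by (simp add: X)
  qed
  have split: "split_at_origin \<in> lim.lim \<rightarrow>\<^sub>M (borel :: ('d sequence \<times> 'd sequence) measure)"
    unfolding split_at_origin_def[abs_def] borel_prod[symmetric]
    by (intro measurable_Pair measurable_coordinatewise_then_product) simp_all
  define \<eta> where "\<eta> = distr lim.lim borel (split_at_origin :: _ \<Rightarrow> 'd sequence \<times> 'd sequence)"
  have \<eta>: "borel_prob \<eta>"
    unfolding \<eta>_def borel_prob_def using lim.P.prob_space_distr[OF split] by simp
  have \<eta>_half: "distr \<eta> borel (halfline n) = M" for n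
    unfolding \<eta>_def
    by (subst distr_distr[OF borel_measurable_two_sided(5) split])
      (simp add: o_def halfline_split_at_origin half_law)
  have "distr \<eta> borel unshift = \<eta>"
  proof (rule borel_prob_eqI_halfline)
    show "borel_prob (distr \<eta> borel unshift)" by (intro borel_prob_distr \<eta>) simp
    show "distr (distr \<eta> borel unshift) borel (halfline n) = distr \<eta> borel (halfline n)" for n
      by (subst distr_distr_borel) (simp_all add: \<eta> halfline_unshift \<eta>_half)
  qed fact
  then have "invariant_prob unshift \<eta>" using \<eta> by (simp add: invariant_prob_def)
  then have "invariant_prob two_sided_shift \<eta>"
    by (rule invariant_prob_inverse) simp_all
  moreover have "distr \<eta> borel fst = M"
    using \<eta>_half[of 0] by (simp add: halfline_def[abs_def])
  ultimately show ?thesis by blast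
qed

lemma invariant_prob_unshift_iff:
  "invariant_prob unshift \<eta> \<longleftrightarrow> invariant_prob two_sided_shift (\<eta> :: ('d::finite sequence \<times> 'd sequence) measure)"
  using invariant_prob_inverse[of unshift \<eta> two_sided_shift]
    invariant_prob_inverse[of two_sided_shift \<eta> unshift] by auto

lemma distr_halfline_invariant:
  fixes \<eta> :: "('d::finite sequence \<times> 'd sequence) measure"
  assumes "invariant_prob two_sided_shift \<eta>"
  shows "distr \<eta> borel (halfline n) = distr \<eta> borel fst"
proof -
  have inv: "invariant_prob unshift \<eta>" using assms by (simp add: invariant_prob_unshift_iff)
  have "distr (distr \<eta> borel (unshift ^^ n)) borel fst = distr \<eta> borel (halfline n)"
    using assms by (subst distr_distr_borel) (simp_all add: invariant_prob_def halfline_def[abs_def])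
  then show ?thesis by (simp add: distr_funpow_invariant[OF inv])
qed

lemma natural_extension_eqI:
  fixes \<eta> :: "('d::finite sequence \<times> 'd sequence) measure"
  assumes "invariant_prob two_sided_shift \<eta>" "distr \<eta> borel fst = M"
  shows "natural_extension M = \<eta>"
  unfolding natural_extension_def
proof (rule the_equality)
  fix \<zeta> :: "('d sequence \<times> 'd sequence) measure"
  assume "invariant_prob two_sided_shift \<zeta> \<and> distr \<zeta> borel fst = M"
  then show "\<zeta> = \<eta>"
    using assms by (intro borel_prob_eqI_halfline)
      (auto simp: distr_halfline_invariant, auto simp: invariant_prob_def)
qed (use assms in simp)

lemma natural_extension:
  fixes M :: "'d::finite sequence measure"
  assumes "invariant_prob shift M"
  shows "invariant_prob two_sided_shift (natural_extension M)"
    and "distr (natural_extension M) borel fst = M"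
proof -
  obtain \<eta> where "invariant_prob two_sided_shift \<eta>" "distr \<eta> borel fst = M"
    using exists_two_sided_extension[OF assms] by blast
  with natural_extension_eqI[OF this]
  show "invariant_prob two_sided_shift (natural_extension M)"
    and "distr (natural_extension M) borel fst = M" by simp_all
qed

text \<open>Reflecting a two-sided sequence at the origin exchanges the shift with its inverse, so a prescribed
  past marginal can be extended just like a prescribed future marginal.\<close>

lemma exists_extension_with_past:
  fixes M :: "'d::finite sequence measure"
  assumes "invariant_prob shift M"
  shows "\<exists>\<eta>. invariant_prob two_sided_shift \<eta> \<and> distr \<eta> borel snd = M"
proof -
  define \<zeta> where "\<zeta> = natural_extension M"
  have \<zeta>: "invariant_prob two_sided_shift \<zeta>" "distr \<zeta> borel fst = M" "borel_prob \<zeta>"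
    using natural_extension[OF assms] by (simp_all add: \<zeta>_def invariant_prob_def)
  have "prod.swap (two_sided_shift p) = unshift (prod.swap p)" for p :: "'d sequence \<times> 'd sequence"
    by (cases p) (simp add: two_sided_shift_def unshift_def tau_def)
  then have "invariant_prob unshift (distr \<zeta> borel prod.swap)"
    by (intro invariant_prob_factor[OF \<zeta>(1)]) simp_all
  moreover have "distr (distr \<zeta> borel prod.swap) borel snd = M"
    using \<zeta> by (subst distr_distr_borel) (simp_all add: comp_def)
  ultimately show ?thesis by (auto simp: invariant_prob_unshift_iff)
qed

lemma invariant_prob_marginals:
  fixes \<eta> :: "('d::finite sequence \<times> 'd sequence) measure"
  assumes "invariant_prob two_sided_shift \<eta>"
  shows "invariant_prob shift (distr \<eta> borel fst)" "invariant_prob shift (distr \<eta> borel snd)"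
proof -
  have inv: "invariant_prob unshift \<eta>" using assms by (simp add: invariant_prob_unshift_iff)
  show "invariant_prob shift (distr \<eta> borel fst)"
    by (rule invariant_prob_factor[OF assms]) (simp_all add: fst_two_sided_shift)
  show "invariant_prob shift (distr \<eta> borel snd)"
    by (rule invariant_prob_factor[OF inv]) (simp_all add: snd_unshift)
qed

section \<open>Forgetting the future\<close>

text \<open>After \<open>n\<close> backward shifts the part of the point that depends on the original future lies beyond
  position \<open>n\<close>. By uniform continuity of \<open>f\<close> it becomes irrelevant, and \<open>f \<circ> unshift ^^ n\<close> can be replaced by a
  function \<open>g n\<close> of the past; the past has the same law under \<open>P\<close> and \<open>Q\<close>.\<close>

lemma unshift_forgets_future:
  fixes f :: "'d::finite sequence \<times> 'd sequence \<Rightarrow> real"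
  assumes f: "continuous_on UNIV f" and P: "borel_prob P" and Q: "borel_prob Q"
    and snd_eq: "distr P borel snd = distr Q borel snd"
  shows "(\<lambda>n. (\<integral>p. f ((unshift ^^ n) p) \<partial>P) - (\<integral>p. f ((unshift ^^ n) p) \<partial>Q)) \<longlonglongrightarrow> 0"
proof -
  define g where "g n y = f ((unshift ^^ n) (undefined, y))" for n y
  have cont_f: "continuous_on UNIV (\<lambda>p. f ((unshift ^^ n) p))" for n
    by (intro continuous_on_compose2[OF f] continuous_intros) auto
  have cont_g: "continuous_on UNIV (g n)" for n
    unfolding g_def by (intro continuous_on_compose2[OF f] continuous_intros) auto
  have cont_g': "continuous_on UNIV (\<lambda>p :: 'd sequence \<times> 'd sequence. g n (snd p))" for n
    by (intro continuous_on_compose2[OF cont_g] continuous_intros) auto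
  have "bounded (range f)"
    by (rule compact_imp_bounded[OF compact_continuous_image[OF f compact_UNIV_two_sided]])
  then obtain B where B: "\<And>p. \<bar>f p\<bar> \<le> B" by (auto simp: bounded_iff)
  have unif: "uniformly_continuous_on UNIV f"
    by (rule compact_uniformly_continuous[OF f compact_UNIV_two_sided])
  have lim: "(\<lambda>n. f ((unshift ^^ n) p) - g n (snd p)) \<longlonglongrightarrow> 0" for p
  proof -
    have "(\<lambda>n. dist (halfline n p) (halfline n (undefined, snd p))) \<longlonglongrightarrow> 0"
      by (rule dist_fun_tendsto_0) (auto intro: halfline_eq_if_same_past)
    then have "(\<lambda>n. dist ((unshift ^^ n) p) ((unshift ^^ n) (undefined, snd p))) \<longlonglongrightarrow> 0"
      by (simp add: dist_prod_def snd_unshift_funpow halfline_def)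
    with unif have "(\<lambda>n. dist (f ((unshift ^^ n) p)) (f ((unshift ^^ n) (undefined, snd p)))) \<longlonglongrightarrow> 0"
      by (simp add: uniformly_continuous_on_sequentially)
    then show ?thesis by (simp add: g_def dist_real_def tendsto_rabs_zero_iff)
  qed
  have main: "(\<lambda>n. (\<integral>p. f ((unshift ^^ n) p) \<partial>R) - (\<integral>y. g n y \<partial>distr R borel snd)) \<longlonglongrightarrow> 0"
    if R: "borel_prob R" for R
  proof -
    interpret prob_space R using R by (simp add: borel_prob_def)
    have int: "integrable R (\<lambda>p. f ((unshift ^^ n) p))" "integrable R (\<lambda>p. g n (snd p))" for n
      by (rule integrable_continuous[OF R compact_UNIV_two_sided], fact cont_f cont_g')+
    have "(\<lambda>n. \<integral>p. f ((unshift ^^ n) p) - g n (snd p) \<partial>R) \<longlonglongrightarrow> (\<integral>p. 0 \<partial>R)"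
    proof (rule integral_dominated_convergence[where w = "\<lambda>_. 2 * B"])
      show "AE p in R. norm (f ((unshift ^^ n) p) - g n (snd p)) \<le> 2 * B" for n
      proof (intro AE_I2)
        show "norm (f ((unshift ^^ n) p) - g n (snd p)) \<le> 2 * B" for p
          using B[of "(unshift ^^ n) p"] B[of "(unshift ^^ n) (undefined, snd p)"]
          by (simp add: g_def)
      qed
      show "AE p in R. (\<lambda>n. f ((unshift ^^ n) p) - g n (snd p)) \<longlonglongrightarrow> 0"
        by (intro AE_I2 lim)
      show "(\<lambda>p. f ((unshift ^^ n) p) - g n (snd p)) \<in> borel_measurable R" for n
        using Bochner_Integration.integrable_diff[OF int(1)[of n] int(2)[of n]] by simp
    qed simp_all
    then show ?thesis
      using R by (simp add: Bochner_Integration.integral_diff[OF int] integral_distr_borel[OF _ _ cont_g])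
  qed
  from tendsto_diff[OF main[OF P] main[OF Q]] show ?thesis by (simp add: snd_eq)
qed

text \<open>The past marginal of \<open>\<eta>\<close> is shift invariant, so all images of \<open>P\<close> under backward shifts keep it. The
  error term \<open>c\<close> depends on the past only; its mean is therefore at most zero at every step, and the
  means of \<open>U\<close> never decrease. In the limit the future is forgotten and the mean under the invariant
  \<open>\<eta>\<close> remains.\<close>

lemma integral_le_if_increasing_along_unshift:
  fixes U :: "'d::finite sequence \<times> 'd sequence \<Rightarrow> real"
  assumes U: "continuous_on UNIV U" and c: "continuous_on UNIV c"
    and incr: "\<And>p. U p \<le> U (unshift p) + c (snd p)"
    and \<eta>: "invariant_prob two_sided_shift \<eta>" and P: "borel_prob P"
    and snd_eq: "distr P borel snd = distr \<eta> borel snd"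
    and c_int: "(\<integral>y. c y \<partial>distr \<eta> borel snd) \<le> 0"
  shows "(\<integral>p. U p \<partial>P) \<le> (\<integral>p. U p \<partial>\<eta>)"
proof -
  let ?past = "distr \<eta> borel snd"
  have \<eta>': "borel_prob \<eta>" "invariant_prob unshift \<eta>"
    using \<eta> unfolding invariant_prob_unshift_iff by (simp_all add: invariant_prob_def)
  have past_inv: "invariant_prob shift ?past"
    using invariant_prob_marginals(2)[OF \<eta>] .
  have cont: "continuous_on UNIV (\<lambda>p. U ((unshift ^^ n) p))" for n
    by (intro continuous_on_compose2[OF U] continuous_intros) auto
  have step: "(\<integral>p. U p \<partial>R) \<le> (\<integral>p. U (unshift p) \<partial>R)"
    if R: "borel_prob R" "distr R borel snd = ?past" for R
  proof -
    have cs: "continuous_on UNIV (\<lambda>p :: 'd sequence \<times> 'd sequence. c (snd p))"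
      by (intro continuous_on_compose2[OF c] continuous_intros) auto
    have "(\<integral>p. U p \<partial>R) \<le> (\<integral>p. U (unshift p) + c (snd p) \<partial>R)"
      using cont[of 1] by (intro integral_mono integrable_continuous R(1) U compact_UNIV_two_sided
          Bochner_Integration.integrable_add cs incr) simp_all
    also have "\<dots> = (\<integral>p. U (unshift p) \<partial>R) + (\<integral>p. c (snd p) \<partial>R)"
      using cont[of 1] by (intro Bochner_Integration.integral_add integrable_continuous R(1)
          compact_UNIV_two_sided cs) simp_all
    also have "(\<integral>p. c (snd p) \<partial>R) = (\<integral>y. c y \<partial>?past)"
      unfolding R(2)[symmetric] by (simp add: integral_distr_borel[OF R(1) _ c])
    finally show ?thesis using c_int by simp
  qed
  have iter: "(\<integral>p. U p \<partial>P) \<le> (\<integral>p. U ((unshift ^^ n) p) \<partial>P)" for n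
  proof (induction n)
    case (Suc n)
    let ?R = "distr P borel (unshift ^^ n)"
    have R: "borel_prob ?R" using P by (intro borel_prob_distr) simp_all
    have shift_n: "shift ^^ n \<in> borel \<rightarrow>\<^sub>M (borel :: 'd sequence measure)"
      by (rule measurable_compose_n) simp
    have "distr ?R borel snd = distr (distr P borel snd) borel (shift ^^ n)"
      using P shift_n by (simp add: distr_distr_borel snd_unshift_funpow)
    also have "\<dots> = ?past"
      using distr_funpow_invariant[OF past_inv] by (simp add: snd_eq)
    finally have "(\<integral>p. U p \<partial>?R) \<le> (\<integral>p. U (unshift p) \<partial>?R)" by (rule step[OF R])
    then show ?case
      using Suc P cont[of 1] by (simp add: integral_distr_borel[OF P] U)
  qed simp
  have "(\<integral>p. U ((unshift ^^ n) p) \<partial>\<eta>) = (\<integral>p. U p \<partial>\<eta>)" for n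
    using integral_distr_borel[OF \<eta>'(1) borel_measurable_two_sided(3) U, of n]
    by (simp add: distr_funpow_invariant[OF \<eta>'(2)])
  with unshift_forgets_future[OF U P \<eta>'(1) snd_eq]
  have "(\<lambda>n. (\<integral>p. U ((unshift ^^ n) p) \<partial>P) - (\<integral>p. U p \<partial>\<eta>)) \<longlonglongrightarrow> 0" by simp
  moreover have "\<exists>N. \<forall>n\<ge>N. (\<integral>p. U p \<partial>P) - (\<integral>p. U p \<partial>\<eta>)
      \<le> (\<integral>p. U ((unshift ^^ n) p) \<partial>P) - (\<integral>p. U p \<partial>\<eta>)"
    using iter by auto
  ultimately show ?thesis
    using LIMSEQ_le_const by fastforce
qed

section \<open>A continuous subaction\<close>

lemma shift_dist_prepend:
  "shift_dist lam (prepend a x) (prepend a x') = lam * shift_dist lam x x'"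
proof (cases "x = x'")
  case False
  then obtain j where j: "x j \<noteq> x' j" by auto
  have "prepend a x \<noteq> prepend a x'" using False by (metis shift_prepend)
  moreover have "(LEAST j. prepend a x j \<noteq> prepend a x' j) = Suc (LEAST j. x j \<noteq> x' j)"
    using Least_Suc[of "\<lambda>j. prepend a x j \<noteq> prepend a x' j" "Suc j"] j by simp
  ultimately show ?thesis using False by (simp add: shift_dist_def)
qed (simp add: shift_dist_def)

lemma shift_dist_halfline:
  "shift_dist lam (halfline n (x, y)) (halfline n (x', y)) = lam ^ n * shift_dist lam x x'"
  by (induction n) (simp_all add: halfline_Suc shift_dist_prepend)

lemma shift_dist_bounds:
  assumes "0 < lam" "lam < 1"
  shows "0 \<le> shift_dist lam x x'" "shift_dist lam x x' \<le> 1"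
  using assms by (simp_all add: shift_dist_def power_le_one)

lemma holderE:
  assumes "holder lam A"
  obtains C \<alpha> where "0 < \<alpha>" "0 \<le> C" "\<And>x x'. \<bar>A x - A x'\<bar> \<le> C * shift_dist lam x x' powr \<alpha>"
proof -
  obtain C \<alpha> where *: "0 < \<alpha>" "\<And>x x'. \<bar>A x - A x'\<bar> \<le> C * shift_dist lam x x' powr \<alpha>"
    using assms by (auto simp: holder_def)
  have "\<bar>A x - A x'\<bar> \<le> max C 0 * shift_dist lam x x' powr \<alpha>" for x x'
    by (rule order_trans[OF *(2)]) (simp add: mult_right_mono)
  with * show ?thesis by (intro that[of \<alpha> "max C 0"]) auto
qed

text \<open>A positive power of the distance is small as soon as sufficiently many initial letters agree, and
  agreement of finitely many letters is an open condition.\<close>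

lemma continuous_on_if_modulus:
  fixes f :: "'d sequence \<Rightarrow> real"
  assumes lam: "0 < lam" "lam < 1" and \<alpha>: "0 < \<alpha>"
    and f: "\<And>x x'. \<bar>f x - f x'\<bar> \<le> K * shift_dist lam x x' powr \<alpha>"
  shows "continuous_on UNIV f"
  unfolding continuous_on_def
proof (intro ballI tendstoI)
  fix x :: "'d sequence" and e :: real assume "0 < e"
  define r where "r = lam powr \<alpha>"
  have r: "0 \<le> r" "r < 1" using lam \<alpha> by (simp_all add: r_def powr01_less_one)
  have "(\<lambda>n. K * r ^ n) \<longlonglongrightarrow> K * 0"
    by (intro tendsto_mult tendsto_const LIMSEQ_power_zero) (use r in simp)
  then have "\<forall>\<^sub>F n in sequentially. \<bar>K\<bar> * r ^ n < e"
    using order_tendstoD(2)[OF tendsto_rabs, of _ 0 sequentially e] \<open>0 < e\<close> r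
    by (fastforce simp: abs_mult)
  then obtain n where n: "\<bar>K\<bar> * r ^ n < e" by (auto simp: eventually_sequentially)
  have "\<forall>\<^sub>F x' in at x within UNIV. \<forall>i\<in>{..n}. x' i = x i"
  proof (rule eventually_ball_finite, simp, rule ballI)
    fix i
    have "continuous_on UNIV (\<lambda>x' :: 'd sequence. x' i)"
      by (rule continuous_on_product_coordinates)
    then have "((\<lambda>x'. x' i) \<longlongrightarrow> x i) (at x within UNIV)"
      unfolding continuous_on_def by blast
    from topological_tendstoD[OF this open_discrete[of "{x i}"]]
    show "\<forall>\<^sub>F x' in at x within UNIV. x' i = x i" by simp
  qed
  then show "\<forall>\<^sub>F x' in at x within UNIV. dist (f x') (f x) < e"
  proof eventually_elim
    case (elim x')
    then have "shift_dist lam x' x < lam ^ n"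
      by (simp add: shift_dist_less_iff[OF lam])
    then have "shift_dist lam x' x powr \<alpha> \<le> (lam ^ n) powr \<alpha>"
      using \<alpha> shift_dist_bounds(1)[OF lam] by (intro powr_mono2) auto
    also have "\<dots> = r ^ n"
      using lam by (simp add: r_def powr_power[symmetric] powr_realpow[symmetric] powr_powr mult.commute)
    finally have "\<bar>K\<bar> * shift_dist lam x' x powr \<alpha> \<le> \<bar>K\<bar> * r ^ n"
      by (intro mult_left_mono) auto
    moreover have "K * shift_dist lam x' x powr \<alpha> \<le> \<bar>K\<bar> * shift_dist lam x' x powr \<alpha>"
      by (intro mult_right_mono) auto
    ultimately show ?case using f[of x' x] n by (simp add: dist_real_def)
  qed
qed

text \<open>The Birkhoff sum of \<open>B\<close> along the backward orbit of \<open>x\<close> of length \<open>n\<close> whose inverse branches are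
  chosen by the letters of \<open>y\<close>; the point \<open>x\<close> itself is left out.\<close>

definition past_sum :: "('d sequence \<Rightarrow> real) \<Rightarrow> nat \<Rightarrow> 'd sequence \<Rightarrow> 'd sequence \<Rightarrow> real" where
  "past_sum B n x y = (\<Sum>k<n. B (halfline (Suc k) (x, y)))"

lemma past_sum_Suc: "past_sum B (Suc n) x y = B (tau y x) + past_sum B n (tau y x) (shift y)"
proof -
  have "halfline (Suc k) (x, y) = halfline k (tau y x, shift y)" for k
    using halfline_unshift[of k "(x, y)"] by (simp add: unshift_def)
  then show ?thesis
    unfolding past_sum_def by (subst sum.lessThan_Suc_shift) simp
qed

text \<open>The bounded distortion estimate: inverse branches contract by \<open>lam\<close>, so the differences along two
  backward orbits with the same branches are dominated by a geometric series, uniformly in the length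
  and in the branches.\<close>

lemma past_sum_holder:
  assumes lam: "0 < lam" "lam < 1" and \<alpha>: "0 < \<alpha>" and C: "0 \<le> C"
    and B: "\<And>x x'. \<bar>B x - B x'\<bar> \<le> C * shift_dist lam x x' powr \<alpha>"
  shows "\<bar>past_sum B n x y - past_sum B n x' y\<bar>
    \<le> C / (1 - lam powr \<alpha>) * shift_dist lam x x' powr \<alpha>"
proof -
  define r where "r = lam powr \<alpha>"
  define D where "D = shift_dist lam x x' powr \<alpha>"
  have r: "0 \<le> r" "r < 1" using lam \<alpha> by (simp_all add: r_def powr01_less_one)
  have D: "0 \<le> D" by (simp add: D_def)
  have term_le: "\<bar>B (halfline (Suc k) (x, y)) - B (halfline (Suc k) (x', y))\<bar> \<le> C * D * r ^ k" for k
  proof -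
    have "(lam ^ Suc k * shift_dist lam x x') powr \<alpha> = r ^ Suc k * D"
      using lam shift_dist_bounds(1)[OF lam]
      by (simp only: powr_mult r_def D_def powr_power)
        (simp add: powr_mult powr_realpow[symmetric] powr_powr powr_add mult.commute algebra_simps)
    moreover have "r ^ Suc k * D \<le> r ^ k * D"
      using r D by (intro mult_right_mono power_decreasing) auto
    ultimately have "C * (lam ^ Suc k * shift_dist lam x x') powr \<alpha> \<le> C * (r ^ k * D)"
      using C by (simp add: mult_left_mono)
    then show ?thesis
      using B[of "halfline (Suc k) (x, y)" "halfline (Suc k) (x', y)"]
      by (simp only: shift_dist_halfline) (simp add: mult_ac)
  qed
  have "\<bar>past_sum B n x y - past_sum B n x' y\<bar>
      \<le> (\<Sum>k<n. \<bar>B (halfline (Suc k) (x, y)) - B (halfline (Suc k) (x', y))\<bar>)"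
    unfolding past_sum_def sum_subtractf[symmetric] by (rule sum_abs)
  also have "\<dots> \<le> (\<Sum>k<n. C * D * r ^ k)" by (intro sum_mono term_le)
  also have "\<dots> = C * D * (\<Sum>k<n. r ^ k)" by (simp add: sum_distrib_left)
  also have "(\<Sum>k<n. r ^ k) \<le> 1 / (1 - r)"
  proof -
    have "(\<Sum>k<n. r ^ k) \<le> (\<Sum>k. r ^ k)"
      using r by (intro sum_le_suminf summable_geometric) auto
    then show ?thesis using r by (simp add: suminf_geometric)
  qed
  then have "C * D * (\<Sum>k<n. r ^ k) \<le> C * D * (1 / (1 - r))"
    using C D by (intro mult_left_mono) auto
  finally show ?thesis by (simp add: r_def D_def)
qed

text \<open>The average is the integral against the uniform distribution on a periodic orbit, which is
  invariant. It is realized as the image of the uniform distribution on \<open>{..<n}\<close>, on which the shift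
  acts as the cyclic permutation \<open>s\<close>.\<close>

lemma periodic_average_le:
  fixes A :: "'d::finite sequence \<Rightarrow> real"
  assumes max: "\<And>\<nu>. invariant_prob shift \<nu> \<Longrightarrow> (\<integral>x. A x \<partial>\<nu>) \<le> m"
    and A: "continuous_on UNIV A" and x: "(shift ^^ n) x = x" "0 < n"
  shows "(\<Sum>k<n. A ((shift ^^ k) x)) \<le> n * m"
proof -
  define orb where "orb k = (shift ^^ k) x" for k
  define p where "p = pmf_of_set {..<n}"
  define \<nu> where "\<nu> = distr (measure_pmf p) borel orb"
  have ne: "{..<n} \<noteq> {}" "finite {..<n}" using x by auto
  have orb: "orb \<in> measure_pmf p \<rightarrow>\<^sub>M borel" by simp
  have \<nu>: "borel_prob \<nu>"
    by (simp add: borel_prob_def \<nu>_def measure_pmf.prob_space_distr[OF orb])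
  define s where "s k = (if Suc k = n then 0 else Suc k)" for k
  have "bij_betw s {..<n} {..<n}"
    by (rule bij_betw_byWitness[where f' = "\<lambda>k. if k = 0 then n - 1 else k - 1"])
      (use x in \<open>auto simp: s_def split: if_splits\<close>)
  then have "map_pmf s p = p"
    unfolding p_def by (rule map_pmf_of_set_bij_betw) (use ne in auto)
  have shift_orb: "shift (orb k) = orb (s k)" for k
    using x(1) by (auto simp: orb_def s_def)
  have "distr \<nu> borel shift = distr (measure_pmf p) borel (\<lambda>k. shift (orb k))"
    unfolding \<nu>_def by (subst distr_distr) (simp_all add: comp_def)
  also have "\<dots> = distr (measure_pmf (map_pmf s p)) borel orb"
    unfolding map_pmf_rep_eq shift_orb by (subst distr_distr) (simp_all add: comp_def)
  also have "\<dots> = \<nu>" by (simp add: \<nu>_def \<open>map_pmf s p = p\<close>)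
  finally have "(\<integral>x. A x \<partial>\<nu>) \<le> m"
    using \<nu> by (intro max) (simp add: invariant_prob_def)
  moreover have "(\<integral>x. A x \<partial>\<nu>) = (\<integral>k. A (orb k) \<partial>measure_pmf p)"
    unfolding \<nu>_def using borel_measurable_continuous_onI[OF A] by (intro integral_distr) simp_all
  moreover have "\<dots> = (\<Sum>k<n. A (orb k)) / n"
    unfolding p_def using ne by (simp add: integral_pmf_of_set)
  ultimately have "(\<Sum>k<n. A (orb k)) / n \<le> m" by linarith
  then show ?thesis using x(2) by (simp add: orb_def divide_le_eq mult.commute)
qed

text \<open>The subaction is the supremum \<open>V x\<close> of the sums of \<open>A - m\<close> over all finite backward orbits of \<open>x\<close>.
  A backward orbit of \<open>z\<close>, extended by \<open>z\<close>, is one of \<open>shift z\<close>; this is the subaction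
  inequality. By bounded distortion each sum is within \<open>K\<close> of the sum along the periodic orbit with
  the same branches, which cannot be positive since \<open>m\<close> bounds all invariant averages. So the
  supremum is finite, and it inherits the common modulus of continuity of the sums.\<close>

lemma exists_continuous_subaction:
  fixes A :: "'d::finite sequence \<Rightarrow> real"
  assumes lam: "0 < lam" "lam < 1" and A: "holder lam A"
    and max: "\<And>\<nu>. invariant_prob shift \<nu> \<Longrightarrow> (\<integral>x. A x \<partial>\<nu>) \<le> m"
  shows "\<exists>V. continuous_on UNIV V \<and> (\<forall>z. A z - m \<le> V (shift z) - V z)"
proof -
  obtain C \<alpha> where \<alpha>: "0 < \<alpha>" and C: "0 \<le> C"
    and hol: "\<And>x x'. \<bar>A x - A x'\<bar> \<le> C * shift_dist lam x x' powr \<alpha>"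
    by (rule holderE[OF A]) (rule that)
  define B where "B z = A z - m" for z
  define K where "K = C / (1 - lam powr \<alpha>)"
  have "lam powr \<alpha> < 1" using lam \<alpha> by (simp add: powr01_less_one)
  then have K: "0 \<le> K" using C by (simp add: K_def)
  have S_hol: "\<bar>past_sum B n x y - past_sum B n x' y\<bar> \<le> K * shift_dist lam x x' powr \<alpha>" for n x x' y
    unfolding K_def using hol by (intro past_sum_holder lam \<alpha> C) (simp add: B_def)
  have dist_le: "K * shift_dist lam x x' powr \<alpha> \<le> K" for x x' :: "'d sequence"
    using shift_dist_bounds[OF lam, of x x'] K \<alpha>
    by (intro mult_left_le) (auto intro: powr_le1)
  have S_le: "past_sum B n x y \<le> K" for n x y
  proof (cases "n = 0")
    case False
    \<comment> \<open>\<open>q\<close> repeats the word \<open>y (n - 1), \<dots>, y 0\<close>; hence \<open>halfline n (q, y) = q\<close>, and the backward orbit of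
      \<open>q\<close> along \<open>y\<close> is its periodic orbit\<close>
    define q where "q i = y (n - 1 - i mod n)" for i
    have half: "halfline k (q, y) = (\<lambda>i. q (n - k + i))" if "k \<le> n" for k
      using that
    proof (induction k)
      case 0
      then show ?case by (auto simp: q_def)
    next
      case (Suc k)
      have "prepend (y k) (\<lambda>i. q (n - k + i)) i = q (n - Suc k + i)" for i
      proof (cases i)
        case 0
        then show ?thesis using Suc.prems by (simp add: q_def)
      next
        case (Suc j)
        then show ?thesis using \<open>Suc k \<le> n\<close> by (simp add: Suc_diff_Suc)
      qed
      then show ?case using Suc by (auto simp: halfline_Suc)
    qed
    have "past_sum B n q y = (\<Sum>k<n. B ((shift ^^ (n - Suc k)) q))"
      unfolding past_sum_def by (intro sum.cong) (simp_all add: half funpow_shift)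
    also have "\<dots> = (\<Sum>k<n. B ((shift ^^ k) q))"
      by (rule sum.nat_diff_reindex)
    also have "\<dots> = (\<Sum>k<n. A ((shift ^^ k) q)) - n * m"
      by (simp add: B_def sum_subtractf)
    also have "\<dots> \<le> 0"
    proof -
      have "(shift ^^ n) q = q" by (rule ext) (simp add: funpow_shift q_def)
      with False show ?thesis
        using periodic_average_le[OF max continuous_on_if_modulus[OF lam \<alpha> hol], of n q] by simp
    qed
    finally show ?thesis using S_hol[of n x y q] dist_le[of x q] by linarith
  qed (use K in \<open>simp add: past_sum_def\<close>)
  define V where "V x = (SUP (n, y). past_sum B n x y)" for x
  have bdd: "bdd_above (range (\<lambda>(n, y). past_sum B n x y))" for x
    using S_le by (intro bdd_aboveI[of _ K]) auto
  have V_upper: "past_sum B n x y \<le> V x" for n x y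
    unfolding V_def using cSUP_upper[OF _ bdd[of x], of "(n, y)"] by simp
  have V_least: "V x \<le> b" if "\<And>n y. past_sum B n x y \<le> b" for x b
    unfolding V_def using that by (intro cSUP_least) auto
  have V_le: "V x \<le> V x' + K * shift_dist lam x x' powr \<alpha>" for x x'
  proof (rule V_least)
    show "past_sum B n x y \<le> V x' + K * shift_dist lam x x' powr \<alpha>" for n y
      using S_hol[of n x y x'] V_upper[of n x' y] by linarith
  qed
  have sym: "shift_dist lam x x' = shift_dist lam x' x" for x x' :: "'d sequence"
    by (simp add: shift_dist_def eq_commute)
  have "\<bar>V x - V x'\<bar> \<le> K * shift_dist lam x x' powr \<alpha>" for x x'
    using V_le[of x x'] V_le[of x' x] sym[of x x'] by simp
  then have "continuous_on UNIV V"
    by (rule continuous_on_if_modulus[OF lam \<alpha>])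
  moreover have "A z - m \<le> V (shift z) - V z" for z
  proof -
    have "V z \<le> V (shift z) - B z"
    proof (rule V_least)
      fix n y
      have "B z + past_sum B n z y = past_sum B (Suc n) (shift z) (prepend (z 0) y)"
        by (simp add: past_sum_Suc tau_def)
      then show "past_sum B n z y \<le> V (shift z) - B z"
        using V_upper[of "Suc n" "shift z" "prepend (z 0) y"] by linarith
    qed
    then show ?thesis by (simp add: B_def)
  qed
  ultimately show ?thesis by blast
qed

section \<open>Optimality of the natural extension\<close>

lemma dual_potential_eq:
  assumes "involution_kernel A W"
  shows "dual_potential A W y = A (tau y x) + W (tau y x, shift y) - W (x, y)"
proof -
  obtain a where a: "\<forall>x. A (tau y x) + W (tau y x, shift y) - W (x, y) = a"
    using assms by (auto simp: involution_kernel_def)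
  then have "dual_potential A W y = a"
    unfolding dual_potential_def by (intro the_equality) auto
  with a show ?thesis by simp
qed

lemma continuous_on_dual_potential:
  assumes "involution_kernel A W" "continuous_on UNIV A"
  shows "continuous_on UNIV (dual_potential A W)"
proof -
  have W: "continuous_on UNIV W" using assms by (simp add: involution_kernel_def)
  have u: "continuous_on UNIV (\<lambda>y. unshift (undefined, y))" by (intro continuous_intros)
  have "continuous_on UNIV (\<lambda>y. A (fst (unshift (undefined, y))) + W (unshift (undefined, y)) - W (undefined, y))"
    by (intro continuous_on_add continuous_on_diff continuous_on_compose2[OF W]
        continuous_on_compose2[OF assms(2)] continuous_on_fst u continuous_on_Pair
        continuous_on_const continuous_on_id) auto
  then show ?thesis
    by (simp add: dual_potential_eq[OF assms(1), where x = undefined, abs_def] unshift_def)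
qed

text \<open>The defining equation of the kernel, read at \<open>p = (x, y)\<close>, says
  \<open>A\<^sup>* y = A (fst (unshift p)) + W (unshift p) - W p\<close>: up to a coboundary, \<open>A\<^sup>*\<close> and \<open>A\<close> are the same
  function on the two-sided shift.\<close>

lemma integral_dual_potential:
  fixes A :: "'d::finite sequence \<Rightarrow> real"
  assumes W: "involution_kernel A W" and A: "continuous_on UNIV A"
    and \<eta>: "invariant_prob two_sided_shift \<eta>"
  shows "(\<integral>y. dual_potential A W y \<partial>distr \<eta> borel snd) = (\<integral>x. A x \<partial>distr \<eta> borel fst)"
proof -
  have \<eta>': "borel_prob \<eta>" "distr \<eta> borel unshift = \<eta>"
    using \<eta> unfolding invariant_prob_unshift_iff[symmetric] by (simp_all add: invariant_prob_def)
  have cW: "continuous_on UNIV W" using W by (simp add: involution_kernel_def)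
  have cA: "continuous_on UNIV (\<lambda>p :: 'd sequence \<times> 'd sequence. A (fst p))"
    by (intro continuous_on_compose2[OF A] continuous_intros) auto
  have inv: "(\<integral>p. f (unshift p) \<partial>\<eta>) = (\<integral>p. f p \<partial>\<eta>)" if "continuous_on UNIV f"
    for f :: "'d sequence \<times> 'd sequence \<Rightarrow> real"
    using integral_distr_borel[OF \<eta>'(1) borel_measurable_two_sided(2) that] \<eta>'(2) by simp
  have int: "integrable \<eta> (\<lambda>p. A (fst (unshift p)))" "integrable \<eta> (\<lambda>p. W (unshift p))" "integrable \<eta> W"
    by (intro integrable_continuous[OF \<eta>'(1) compact_UNIV_two_sided] continuous_on_compose2[OF cA]
        continuous_on_compose2[OF cW] continuous_on_unshift continuous_on_id cW; simp)+
  have "(\<integral>y. dual_potential A W y \<partial>distr \<eta> borel snd) = (\<integral>p. dual_potential A W (snd p) \<partial>\<eta>)"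
    by (intro integral_distr_borel \<eta>' continuous_on_dual_potential W A) simp
  also have "\<dots> = (\<integral>p. A (fst (unshift p)) + W (unshift p) - W p \<partial>\<eta>)"
    by (rule arg_cong[where f = "integral\<^sup>L \<eta>"]) (auto simp: dual_potential_eq[OF W] unshift_def)
  also have "\<dots> = (\<integral>p. A (fst p) \<partial>\<eta>)"
    using int by (simp add: inv[OF cA] inv[OF cW])
  also have "\<dots> = (\<integral>x. A x \<partial>distr \<eta> borel fst)"
    by (intro integral_distr_borel[symmetric] \<eta>' A) simp
  finally show ?thesis .
qed

text \<open>Marginals of two-sided invariant measures give \<open>A\<close> and its dual the same integral. So \<open>A\<close> and the
  dual potential have the same maximal value, and an invariant two-sided measure with past marginal
  \<open>mu_star\<close> has a maximizing future marginal. By uniqueness that marginal is \<open>mu\<close>, and the measure is the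
  natural extension of \<open>mu\<close>.\<close>

lemma past_marginal_natural_extension:
  fixes A :: "'d::finite sequence \<Rightarrow> real"
  assumes A: "continuous_on UNIV A" and mu: "maximizing A mu"
    and uniq: "\<And>nu. maximizing A nu \<Longrightarrow> nu = mu"
    and W: "involution_kernel A W" and mu_star: "maximizing (dual_potential A W) mu_star"
  shows "distr (natural_extension mu) borel snd = mu_star"
proof -
  have inv: "invariant_prob shift mu" "invariant_prob shift mu_star"
    using mu mu_star by (simp_all add: maximizing_def)
  note \<eta> = natural_extension[OF inv(1)]
  obtain \<zeta> where \<zeta>: "invariant_prob two_sided_shift \<zeta>" "distr \<zeta> borel snd = mu_star"
    using exists_extension_with_past[OF inv(2)] by blast
  have "(\<integral>x. A x \<partial>mu) = (\<integral>y. dual_potential A W y \<partial>distr (natural_extension mu) borel snd)"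
    by (simp add: integral_dual_potential[OF W A \<eta>(1)] \<eta>(2))
  also have "\<dots> \<le> (\<integral>y. dual_potential A W y \<partial>mu_star)"
    using mu_star invariant_prob_marginals(2)[OF \<eta>(1)] by (simp add: maximizing_def)
  also have "\<dots> = (\<integral>x. A x \<partial>distr \<zeta> borel fst)"
    using integral_dual_potential[OF W A \<zeta>(1)] by (simp add: \<zeta>(2))
  finally have "maximizing A (distr \<zeta> borel fst)"
    using mu invariant_prob_marginals(1)[OF \<zeta>(1)] by (force simp: maximizing_def)
  then have "natural_extension mu = \<zeta>"
    by (intro natural_extension_eqI \<zeta> uniq)
  then show ?thesis using \<zeta>(2) by simp
qed

theorem theorem1:
  fixes lam :: real
    and A :: "'d::finite sequence \<Rightarrow> real"
    and W :: "'d sequence \<times> 'd sequence \<Rightarrow> real"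
    and mu mu_star :: "'d sequence measure"
  assumes "0 < lam" and "lam < 1"
    and "holder lam A"
    and "maximizing A mu" and "\<And>nu. maximizing A nu \<Longrightarrow> nu = mu"
    and "involution_kernel A W"
    and "maximizing (dual_potential A W) mu_star"
  shows "kantorovich_minimizer (\<lambda>p. - W p) mu mu_star (natural_extension mu)"
proof -
  define m where "m = (\<integral>x. A x \<partial>mu)"
  define \<eta> where "\<eta> = natural_extension mu"
  have cA: "continuous_on UNIV A"
    using assms(1-3) by (metis continuous_on_if_modulus holderE)
  have cW: "continuous_on UNIV W" using assms(6) by (simp add: involution_kernel_def)
  have \<eta>: "invariant_prob two_sided_shift \<eta>" "distr \<eta> borel fst = mu"
    using natural_extension[of mu] assms(4) by (simp_all add: \<eta>_def maximizing_def)
  have \<eta>_past: "distr \<eta> borel snd = mu_star"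
    unfolding \<eta>_def by (rule past_marginal_natural_extension[OF cA assms(4-7)])
  have \<eta>_prob: "borel_prob \<eta>" using \<eta>(1) by (simp add: invariant_prob_def)
  have "\<And>\<nu>. invariant_prob shift \<nu> \<Longrightarrow> (\<integral>x. A x \<partial>\<nu>) \<le> m"
    using assms(4) by (simp add: maximizing_def m_def)
  then obtain V where cV: "continuous_on UNIV V" and V: "\<And>z. A z - m \<le> V (shift z) - V z"
    using exists_continuous_subaction[OF assms(1-3), of m] by blast
  \<comment> \<open>the correction \<open>V\<close> has the same mean under all couplings, and it turns the cohomological
    equation of the kernel into an inequality along backward orbits\<close>
  define U where "U p = W p - V (fst p)" for p
  have cV': "continuous_on UNIV (\<lambda>p :: 'd sequence \<times> 'd sequence. V (fst p))"
    by (intro continuous_on_compose2[OF cV] continuous_intros) auto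
  have cU: "continuous_on UNIV U"
    unfolding U_def by (intro continuous_intros cW cV')
  have U_int: "(\<integral>p. W p \<partial>P) = (\<integral>p. U p \<partial>P) + (\<integral>x. V x \<partial>mu)"
    if P: "borel_prob P" "distr P borel fst = mu" for P
  proof -
    have "(\<integral>p. U p \<partial>P) = (\<integral>p. W p \<partial>P) - (\<integral>p. V (fst p) \<partial>P)"
      unfolding U_def by (intro Bochner_Integration.integral_diff
          integrable_continuous[OF P(1) compact_UNIV_two_sided] cW cV')
    also have "(\<integral>p. V (fst p) \<partial>P) = (\<integral>x. V x \<partial>mu)"
      unfolding P(2)[symmetric] by (intro integral_distr_borel[symmetric] P cV) simp
    finally show ?thesis by simp
  qed
  have "(\<integral>p. W p \<partial>P) \<le> (\<integral>p. W p \<partial>\<eta>)" if "P \<in> couplings mu mu_star" for P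
  proof -
    have P: "borel_prob P" "distr P borel fst = mu" "distr P borel snd = mu_star"
      using that by (simp_all add: couplings_def)
    have "(\<integral>p. U p \<partial>P) \<le> (\<integral>p. U p \<partial>\<eta>)"
    proof (rule integral_le_if_increasing_along_unshift[where c = "\<lambda>y. m - dual_potential A W y"])
      show "U p \<le> U (unshift p) + (m - dual_potential A W (snd p))" for p
        using V[of "fst (unshift p)"]
        by (cases p) (simp add: U_def unshift_def dual_potential_eq[OF assms(6), of _ "fst p"] tau_def)
      show "continuous_on UNIV (\<lambda>y. m - dual_potential A W y)"
        by (intro continuous_intros continuous_on_dual_potential assms(6) cA)
      have "borel_prob mu_star"
        using assms(7) by (simp add: maximizing_def invariant_prob_def)
      then have "integrable mu_star (dual_potential A W)" and "prob_space mu_star"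
        by (auto intro!: integrable_continuous compact_UNIV_sequence continuous_on_dual_potential
            assms(6) cA simp: borel_prob_def)
      then show "(\<integral>y. m - dual_potential A W y \<partial>distr \<eta> borel snd) \<le> 0"
        using integral_dual_potential[OF assms(6) cA \<eta>(1)]
        by (simp add: \<eta>_past \<eta>(2) m_def prob_space.prob_space prob_space.finite_measure
            finite_measure.integrable_const)
    qed (use \<eta> \<eta>_past P cU in simp_all)
    then show ?thesis using U_int[OF P(1,2)] U_int[OF \<eta>_prob \<eta>(2)] by simp
  qed
  moreover have "\<eta> \<in> couplings mu mu_star"
    using \<eta>_prob \<eta>(2) \<eta>_past by (simp add: couplings_def)
  ultimately show ?thesis
    by (simp add: kantorovich_minimizer_def is_arg_min_linorder \<eta>_def[symmetric])
qed

end
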